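(* Let $\mathbb{F}$ be an algebraically closed field of characteristic $p>2$. Let $L_{p,p}$ be the model filiform Lie superalgebra with even basis $X_1,\ldots,X_p$, odd basis $Y_1,\ldots,Y_p$ and super-brackets $[X_1,X_i]=X_{i+1}$ for $2\le i\le p-1$, $[X_1,Y_j]=Y_{j+1}$ for $1\le j\le p-1$, all other brackets of basis elements (not determined by these via super-skew-symmetry) being zero. For every $\lambda=(\lambda_1,\ldots,\lambda_p)\in\mathbb{F}^p$, the map $[p]:(L_{p,p})_{\bar0}\to(L_{p,p})_{\bar0}$ given by $$\Big(\sum_{k=1}^pa_kX_k\Big)^{[p]}=\Big(\sum_{k=1}^pa_k^p\lambda_k\Big)X_p\qquad(a_k\in\mathbb F)$$ makes $L_{p,p}$ a restricted Lie superalgebra (denoted $L_{p,p}^{\lambda}$).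
   Context: A Lie superalgebra is a superspace $L=L_{\bar0}\oplus L_{\bar1}$ with an even bilinear bracket satisfying $[x,y]=-(-1)^{|x||y|}[y,x]$ and $[x,[y,z]]=[[x,y],z]+(-1)^{|x||y|}[y,[x,z]]$, where $|x|$ is the parity. A restricted Lie superalgebra is a Lie superalgebra $L$ with a map $[p]:L_{\bar0}\to L_{\bar0}$, $x\mapsto x^{[p]}$, such that $(L_{\bar0},[p])$ is a restricted Lie algebra (in the usual sense of Jacobson) and $L_{\bar1}$ is a restricted $L_{\bar0}$-module, i.e. $[x^{[p]},y]=(\mathrm{ad}x)^p(y)$ for $x\in L_{\bar0}$, $y\in L_{\bar1}$. *)

theory Defs
  imports
    "HOL-Computational_Algebra.Computational_Algebra"
    "HOL-Library.Function_Algebras"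
    "HOL-Library.Z2"
begin

definition bilinear_bracket_on ::
  "('a::field \<Rightarrow> 'v::ab_group_add \<Rightarrow> 'v) \<Rightarrow> 'v set \<Rightarrow> ('v \<Rightarrow> 'v \<Rightarrow> 'v) \<Rightarrow> bool"
  where
  "bilinear_bracket_on scale V br \<longleftrightarrow>
     (\<forall>x\<in>V. \<forall>y\<in>V. br x y \<in> V) \<and>
     (\<forall>x\<in>V. \<forall>y\<in>V. \<forall>z\<in>V. br (x + y) z = br x z + br y z) \<and>
     (\<forall>x\<in>V. \<forall>y\<in>V. \<forall>z\<in>V. br x (y + z) = br x y + br x z) \<and>
     (\<forall>c. \<forall>x\<in>V. \<forall>y\<in>V. br (scale c x) y = scale c (br x y)) \<and>
     (\<forall>c. \<forall>x\<in>V. \<forall>y\<in>V. br x (scale c y) = scale c (br x y))"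

locale lie_algebra = vector_space scale
  for scale :: "'a::field \<Rightarrow> 'v::ab_group_add \<Rightarrow> 'v" +
  fixes L :: "'v set" and br :: "'v \<Rightarrow> 'v \<Rightarrow> 'v"
  assumes subspace_L: "subspace L"
    and bilinear_L: "bilinear_bracket_on scale L br"
    and alternating: "x \<in> L \<Longrightarrow> br x x = 0"
    and jacobi: "\<lbrakk>x \<in> L; y \<in> L; z \<in> L\<rbrakk> \<Longrightarrow>
          br x (br y z) = br (br x y) z + br y (br x z)"

text \<open>
  Jacobson's elements \<open>s\<^sub>i(x, y)\<close>, for \<open>1 \<le> i \<le> p - 1\<close>: in \<open>L[t]\<close> the coefficient of
  \<open>t\<^bsup>i-1\<^esup>\<close> in \<open>(ad (t x + y))\<^bsup>p-1\<^esup> (x)\<close> is \<open>i s\<^sub>i(x, y)\<close>. Elements of \<open>L[t]\<close> are polynomials with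
  coefficients in \<open>L\<close>, and \<open>pCons 0\<close> is multiplication by \<open>t\<close>.
\<close>

definition ad_poly :: "('v::ab_group_add \<Rightarrow> 'v \<Rightarrow> 'v) \<Rightarrow> 'v \<Rightarrow> 'v \<Rightarrow> 'v poly \<Rightarrow> 'v poly"
  where "ad_poly br x y q = pCons 0 (map_poly (br x) q) + map_poly (br y) q"

definition jacobson_s ::
  "('a::field \<Rightarrow> 'v::ab_group_add \<Rightarrow> 'v) \<Rightarrow> ('v \<Rightarrow> 'v \<Rightarrow> 'v) \<Rightarrow> nat \<Rightarrow> nat \<Rightarrow> 'v \<Rightarrow> 'v \<Rightarrow> 'v"
  where "jacobson_s scale br p i x y =
    scale (inverse (of_nat i)) (coeff ((ad_poly br x y ^^ (p - 1)) [:x:]) (i - 1))"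

locale restricted_lie_algebra = lie_algebra scale L br
  for scale :: "'a::field \<Rightarrow> 'v::ab_group_add \<Rightarrow> 'v" and L :: "'v set"
    and br :: "'v \<Rightarrow> 'v \<Rightarrow> 'v" +
  fixes p :: nat and pmap :: "'v \<Rightarrow> 'v"
  assumes prime_p: "prime p"
    and char_p: "CHAR('a) = p"
    and pmap_closed: "x \<in> L \<Longrightarrow> pmap x \<in> L"
    and ad_pmap: "\<lbrakk>x \<in> L; y \<in> L\<rbrakk> \<Longrightarrow> br (pmap x) y = (br x ^^ p) y"
    and pmap_scale: "x \<in> L \<Longrightarrow> pmap (scale c x) = scale (c ^ p) (pmap x)"
    and pmap_add: "\<lbrakk>x \<in> L; y \<in> L\<rbrakk> \<Longrightarrow>
          pmap (x + y) = pmap x + pmap y + (\<Sum>i=1..p-1. jacobson_s scale br p i x y)"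

definition super_carrier :: "(bit \<Rightarrow> 'v::ab_group_add set) \<Rightarrow> 'v set"
  where "super_carrier L = {x + y |x y. x \<in> L 0 \<and> y \<in> L 1}"

definition super_sign :: "bit \<Rightarrow> bit \<Rightarrow> 'a::ring_1"
  where "super_sign i j = (if i = 1 \<and> j = 1 then - 1 else 1)"

locale lie_superalgebra = vector_space scale
  for scale :: "'a::field \<Rightarrow> 'v::ab_group_add \<Rightarrow> 'v" +
  fixes L :: "bit \<Rightarrow> 'v set" and br :: "'v \<Rightarrow> 'v \<Rightarrow> 'v"
  assumes subspace_part: "subspace (L i)"
    and direct: "L 0 \<inter> L 1 = {0}"
    and bilinear_super: "bilinear_bracket_on scale (super_carrier L) br"
    and bracket_even: "\<lbrakk>x \<in> L i; y \<in> L j\<rbrakk> \<Longrightarrow> br x y \<in> L (i + j)"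
    and super_skew: "\<lbrakk>x \<in> L i; y \<in> L j\<rbrakk> \<Longrightarrow> br x y = - scale (super_sign i j) (br y x)"
    and super_jacobi: "\<lbrakk>x \<in> L i; y \<in> L j; z \<in> L k\<rbrakk> \<Longrightarrow>
          br x (br y z) = br (br x y) z + scale (super_sign i j) (br y (br x z))"

locale restricted_lie_superalgebra =
  lie_superalgebra scale L br + even: restricted_lie_algebra scale "L 0" br p pmap
  for scale :: "'a::field \<Rightarrow> 'v::ab_group_add \<Rightarrow> 'v" and L :: "bit \<Rightarrow> 'v set"
    and br :: "'v \<Rightarrow> 'v \<Rightarrow> 'v" and p :: nat and pmap :: "'v \<Rightarrow> 'v" +
  assumes restricted_odd_module:
    "\<lbrakk>x \<in> L 0; y \<in> L 1\<rbrakk> \<Longrightarrow> br (pmap x) y = (br x ^^ p) y"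

text \<open>
  Vectors are coordinate functions on \<open>nat + nat\<close>; the index \<open>Inl i\<close> belongs to the even basis
  vector \<open>X\<^sub>i\<close> and \<open>Inr j\<close> to the odd basis vector \<open>Y\<^sub>j\<close>.
\<close>

definition fscale :: "'a::field \<Rightarrow> ('b \<Rightarrow> 'a) \<Rightarrow> ('b \<Rightarrow> 'a)"
  where "fscale c x = (\<lambda>b. c * x b)"

global_interpretation fvec: vector_space fscale
  by unfold_locales (auto simp: fscale_def fun_eq_iff algebra_simps)

definition basis_vec :: "'b \<Rightarrow> 'b \<Rightarrow> 'a::field"
  where "basis_vec b = (\<lambda>c. if c = b then 1 else 0)"

abbreviation X :: "nat \<Rightarrow> nat + nat \<Rightarrow> 'a::field"
  where "X i \<equiv> basis_vec (Inl i)"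

abbreviation Y :: "nat \<Rightarrow> nat + nat \<Rightarrow> 'a::field"
  where "Y j \<equiv> basis_vec (Inr j)"

definition filiform_part :: "nat \<Rightarrow> nat \<Rightarrow> bit \<Rightarrow> (nat + nat \<Rightarrow> 'a::field) set"
  where "filiform_part n m i =
    (if i = 0 then fvec.span (X ` {1..n}) else fvec.span (Y ` {1..m}))"

fun filiform_table :: "nat \<Rightarrow> nat \<Rightarrow> nat + nat \<Rightarrow> nat + nat \<Rightarrow> (nat + nat \<Rightarrow> 'a::field)"
  where
  "filiform_table n m (Inl i) (Inl j) =
     (if i = 1 \<and> 2 \<le> j \<and> j \<le> n - 1 then X (j + 1)
      else if j = 1 \<and> 2 \<le> i \<and> i \<le> n - 1 then - X (i + 1)
      else 0)"
| "filiform_table n m (Inl i) (Inr j) =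
     (if i = 1 \<and> 1 \<le> j \<and> j \<le> m - 1 then Y (j + 1) else 0)"
| "filiform_table n m (Inr j) (Inl i) =
     (if i = 1 \<and> 1 \<le> j \<and> j \<le> m - 1 then - Y (j + 1) else 0)"
| "filiform_table n m (Inr i) (Inr j) = 0"

definition filiform_bracket ::
  "nat \<Rightarrow> nat \<Rightarrow> (nat + nat \<Rightarrow> 'a::field) \<Rightarrow> (nat + nat \<Rightarrow> 'a) \<Rightarrow> (nat + nat \<Rightarrow> 'a)"
  where "filiform_bracket n m x y =
    (\<Sum>b\<in>{1..n} <+> {1..m}. \<Sum>c\<in>{1..n} <+> {1..m}.
       fscale (x b * y c) (filiform_table n m b c))"

definition filiform_pmap :: "nat \<Rightarrow> (nat \<Rightarrow> 'a::field) \<Rightarrow> (nat + nat \<Rightarrow> 'a) \<Rightarrow> (nat + nat \<Rightarrow> 'a)"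
  where "filiform_pmap p lam x = fscale (\<Sum>k=1..p. x (Inl k) ^ p * lam k) (X p)"

lemma fun_sum_apply: "(\<Sum>k\<in>A. f k) b = (\<Sum>k\<in>A. f k b)"
  for f :: "'i \<Rightarrow> 'b \<Rightarrow> 'a::comm_monoid_add"
  by (induction A rule: infinite_finite_induct) auto

lemma independent_basis_vec: "fvec.independent (range (basis_vec :: 'b \<Rightarrow> 'b \<Rightarrow> 'a::field))"
proof -
  have inj: "inj (basis_vec :: 'b \<Rightarrow> 'b \<Rightarrow> 'a)"
    by (auto simp: inj_def basis_vec_def fun_eq_iff split: if_splits)
  have key: "u (basis_vec b) = 0"
    if fin: "finite B" and sum0: "(\<Sum>b\<in>B. fscale (u (basis_vec b)) (basis_vec b)) = 0" and "b \<in> B"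
    for B :: "'b set" and u :: "('b \<Rightarrow> 'a) \<Rightarrow> 'a" and b
  proof -
    have "(\<Sum>c\<in>B. fscale (u (basis_vec c)) (basis_vec c)) b = 0"
      by (simp add: sum0)
    moreover have "(\<Sum>c\<in>B. fscale (u (basis_vec c)) (basis_vec c)) b = 
        (\<Sum>c\<in>B. if b = c then u (basis_vec c) else 0)"
      unfolding fun_sum_apply by (rule sum.cong) (auto simp: fscale_def basis_vec_def)
    ultimately show ?thesis
      using fin \<open>b \<in> B\<close> by simp
  qed
  have "\<forall>v\<in>T. u v = 0"
    if T: "finite T" "T \<subseteq> range basis_vec" and sum0: "(\<Sum>v\<in>T. fscale (u v) v) = 0"
    for T and u :: "('b \<Rightarrow> 'a) \<Rightarrow> 'a"
  proof -
    obtain B where B: "T = basis_vec ` B"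
      using T(2) by (auto simp: subset_image_iff)
    have injB: "inj_on (basis_vec :: 'b \<Rightarrow> 'b \<Rightarrow> 'a) B"
      using inj by (rule inj_on_subset) simp
    have "finite B"
      using T(1) injB B by (simp add: finite_image_iff)
    moreover have "(\<Sum>b\<in>B. fscale (u (basis_vec b)) (basis_vec b)) = 0"
      using sum0 unfolding B by (simp add: sum.reindex[OF injB])
    ultimately show ?thesis
      using key B by blast
  qed
  then show ?thesis
    by (auto simp: fvec.dependent_explicit)
qed

lemma filiform_bracket_basis:
  assumes "b \<in> {1..n} <+> {1..m}" "c \<in> {1..n} <+> {1..m}"
  shows "filiform_bracket n m (basis_vec b) (basis_vec c) = filiform_table n m b c"
proof -
  let ?I = "{1..n} <+> {1..m}"
  have fin: "finite ?I" by simp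
  have "filiform_bracket n m (basis_vec b) (basis_vec c) =
      (\<Sum>b'\<in>?I. \<Sum>c'\<in>?I. if c = c' then (if b = b' then filiform_table n m b' c' else 0) else 0)"
    unfolding filiform_bracket_def
    by (intro sum.cong refl) (auto simp: basis_vec_def fscale_def fun_eq_iff)
  also have "\<dots> = (\<Sum>b'\<in>?I. if b = b' then filiform_table n m b' c else 0)"
    using assms fin by (simp add: sum.delta')
  also have "\<dots> = filiform_table n m b c"
    using assms fin by (simp add: sum.delta')
  finally show ?thesis .
qed

lemma filiform_pmap_basis:
  "filiform_pmap p lam (\<Sum>k=1..p. fscale (a k) (X k)) = fscale (\<Sum>k=1..p. a k ^ p * lam k) (X p)"
proof -
  have "(\<Sum>k=1..p. fscale (a k) (X k)) (Inl j) = a j" if "j \<in> {1..p}" for j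
  proof -
    have "(\<Sum>k=1..p. fscale (a k) (X k)) (Inl j) = (\<Sum>k=1..p. if j = k then a k else 0)"
      unfolding fun_sum_apply by (rule sum.cong) (auto simp: fscale_def basis_vec_def)
    also have "\<dots> = a j" using that by simp
    finally show ?thesis .
  qed
  then show ?thesis
    unfolding filiform_pmap_def by (intro arg_cong[where f = "\<lambda>c. fscale c (X p)"] sum.cong) auto
qed

end

(* The bracket of L_{n,m} raises the index of a basis vector, and X_p is central. Hence both sides of
   the identities ad (x^[p]) = (ad x)^p vanish, and so do Jacobson's elements s_i(x, y): they are
   coefficients of (p - 1)-fold brackets of even elements, which already vanish in L_{p,p} because
   [L_0, L_0] is spanned by X_3, ..., X_p. What remains is that [p] is p-semilinear, i.e. Frobenius. *)
theory Submission
  imports Defs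
begin

section \<open>Graded parts as spaces of coordinate functions\<close>

lemma span_basis_vec:
  assumes "finite S"
  shows "fvec.span (basis_vec ` S) = {x :: 'b \<Rightarrow> 'a::field. \<forall>b. b \<notin> S \<longrightarrow> x b = 0}"
proof
  have "fvec.subspace {x :: 'b \<Rightarrow> 'a. \<forall>b. b \<notin> S \<longrightarrow> x b = 0}"
    by (auto simp: fvec.subspace_def fscale_def)
  then show "fvec.span (basis_vec ` S) \<subseteq> {x :: 'b \<Rightarrow> 'a. \<forall>b. b \<notin> S \<longrightarrow> x b = 0}"
    by (rule fvec.span_minimal[rotated]) (auto simp: basis_vec_def)
next
  show "{x :: 'b \<Rightarrow> 'a. \<forall>b. b \<notin> S \<longrightarrow> x b = 0} \<subseteq> fvec.span (basis_vec ` S)"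
  proof
    fix x :: "'b \<Rightarrow> 'a" assume x: "x \<in> {x. \<forall>b. b \<notin> S \<longrightarrow> x b = 0}"
    have "x b = (\<Sum>c\<in>S. fscale (x c) (basis_vec c)) b" for b
    proof -
      have "(\<Sum>c\<in>S. fscale (x c) (basis_vec c)) b = (\<Sum>c\<in>S. if b = c then x c else 0)"
        unfolding fun_sum_apply by (rule sum.cong) (auto simp: fscale_def basis_vec_def)
      then show ?thesis using x assms by simp
    qed
    then have "x = (\<Sum>c\<in>S. fscale (x c) (basis_vec c))" ..
    also have "\<dots> \<in> fvec.span (basis_vec ` S)"
      by (intro fvec.span_sum fvec.span_scale fvec.span_base) auto
    finally show "x \<in> fvec.span (basis_vec ` S)" .
  qed
qed

lemma mem_filiform_part_0:
  "x \<in> filiform_part n m 0 \<longleftrightarrow> (\<forall>k. k \<notin> {1..n} \<longrightarrow> x (Inl k) = 0) \<and> (\<forall>k. x (Inr k) = 0)"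
proof -
  have "filiform_part n m 0 = fvec.span (basis_vec ` Inl ` {1..n})"
    by (simp add: filiform_part_def image_image)
  then show ?thesis
    by (simp only: span_basis_vec finite_imageI finite_atLeastAtMost mem_Collect_eq)
      (auto simp: image_iff Bex_def split_sum_all)
qed

lemma mem_filiform_part_1:
  "x \<in> filiform_part n m 1 \<longleftrightarrow> (\<forall>k. x (Inl k) = 0) \<and> (\<forall>k. k \<notin> {1..m} \<longrightarrow> x (Inr k) = 0)"
proof -
  have "filiform_part n m 1 = fvec.span (basis_vec ` Inr ` {1..m})"
    by (simp add: filiform_part_def image_image)
  then show ?thesis
    by (simp only: span_basis_vec finite_imageI finite_atLeastAtMost mem_Collect_eq)
      (auto simp: image_iff Bex_def split_sum_all)
qed

lemma subspace_filiform_part: "fvec.subspace (filiform_part n m i)"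
  by (simp add: filiform_part_def)

lemma mem_super_carrier_filiform_part:
  "x \<in> super_carrier (filiform_part n m) \<longleftrightarrow>
     (\<forall>k. k \<notin> {1..n} \<longrightarrow> x (Inl k) = 0) \<and> (\<forall>k. k \<notin> {1..m} \<longrightarrow> x (Inr k) = 0)"
  (is "_ \<longleftrightarrow> ?R")
proof
  assume "x \<in> super_carrier (filiform_part n m)"
  then show ?R
    by (auto simp: super_carrier_def mem_filiform_part_0 mem_filiform_part_1)
next
  assume R: ?R
  let ?y = "case_sum (\<lambda>k. x (Inl k)) (\<lambda>_. 0)" and ?z = "case_sum (\<lambda>_. 0) (\<lambda>k. x (Inr k))"
  have "x = ?y + ?z" by (auto simp: fun_eq_iff split_sum_all)
  moreover have "?y \<in> filiform_part n m 0" "?z \<in> filiform_part n m 1"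
    using R by (auto simp: mem_filiform_part_0 mem_filiform_part_1)
  ultimately show "x \<in> super_carrier (filiform_part n m)"
    unfolding super_carrier_def by blast
qed

section \<open>The bracket in coordinates\<close>

lemma sum_sum_delta:
  assumes "finite A" "finite B"
  shows "(\<Sum>i\<in>A. \<Sum>j\<in>B. if i = a \<and> j = b then c else 0) = (if a \<in> A \<and> b \<in> B then c else 0)"
proof -
  have "(\<Sum>j\<in>B. if i = a \<and> j = b then c else 0) = (if i = a then if b \<in> B then c else 0 else 0)" for i
    using assms(2) by (cases "i = a") auto
  then show ?thesis using assms(1) by simp
qed

text \<open>Only brackets with \<open>X 1\<close> are nonzero and they raise the index by one, so a
  single pair survives for each order of the arguments. The bound is 3 because \<open>X 2\<close> is
  the first even vector that \<open>X 1\<close> moves.\<close>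

lemma filiform_bracket_Inl:
  fixes x y :: "nat + nat \<Rightarrow> 'a::field"
  shows "filiform_bracket n m x y (Inl k) =
     (if 3 \<le> k \<and> k \<le> n then x (Inl 1) * y (Inl (k - 1)) - x (Inl (k - 1)) * y (Inl 1) else 0)"
proof -
  \<comment> \<open>\<open>?A\<close> comes from the brackets of \<open>X 1\<close> with
    \<open>X j\<close>, \<open>?B\<close> from those of \<open>X i\<close> with \<open>X 1\<close>;
    the range of the table, 2 to \<open>n - 1\<close>, is rewritten as a range for the target index
    \<open>k\<close>.\<close>
  let ?A = "\<lambda>i j. if i = 1 \<and> k = Suc j \<and> 3 \<le> k \<and> k \<le> n then x (Inl i) * y (Inl j) else 0"
  let ?B = "\<lambda>i j. if j = 1 \<and> k = Suc i \<and> 3 \<le> k \<and> k \<le> n then x (Inl i) * y (Inl j) else 0"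
  have "filiform_bracket n m x y (Inl k) =
      (\<Sum>i\<in>{1..n}. \<Sum>j\<in>{1..n}. ?A i j - ?B i j)"
  proof -
    have table:
      "fscale (x (Inl i) * y (Inl j)) (filiform_table n m (Inl i) (Inl j)) (Inl k) = ?A i j - ?B i j"
      "fscale c (filiform_table n m (Inl i) (Inr j)) (Inl k) = 0"
      "fscale c (filiform_table n m (Inr j) (Inl i)) (Inl k) = 0"
      "fscale c (filiform_table n m (Inr i) (Inr j)) (Inl k) = 0"
      for i j and c :: 'a
      by (auto simp: fscale_def basis_vec_def)
    show ?thesis
      unfolding filiform_bracket_def fun_sum_apply
      by (simp add: sum.Plus table del: filiform_table.simps)
  qed
  also have "\<dots> = (\<Sum>i\<in>{1..n}. \<Sum>j\<in>{1..n}. ?A i j) - (\<Sum>i\<in>{1..n}. \<Sum>j\<in>{1..n}. ?B i j)"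
    by (simp add: sum_subtractf)
  \<comment> \<open>Solving \<open>k = Suc j\<close> for \<open>j\<close> is safe under truncated
    subtraction, since the guard keeps \<open>k\<close> positive.\<close>
  also have "(\<Sum>i\<in>{1..n}. \<Sum>j\<in>{1..n}. ?A i j) =
      (\<Sum>i\<in>{1..n}. \<Sum>j\<in>{1..n}. if i = 1 \<and> j = k - 1 then
        (if 3 \<le> k \<and> k \<le> n then x (Inl 1) * y (Inl (k - 1)) else 0) else 0)"
    by (intro sum.cong refl) auto
  also have "\<dots> = (if 3 \<le> k \<and> k \<le> n then x (Inl 1) * y (Inl (k - 1)) else 0)"
    by (subst sum_sum_delta) auto
  also have "(\<Sum>i\<in>{1..n}. \<Sum>j\<in>{1..n}. ?B i j) =
      (\<Sum>i\<in>{1..n}. \<Sum>j\<in>{1..n}. if i = k - 1 \<and> j = 1 then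
        (if 3 \<le> k \<and> k \<le> n then x (Inl (k - 1)) * y (Inl 1) else 0) else 0)"
    by (intro sum.cong refl) auto
  also have "\<dots> = (if 3 \<le> k \<and> k \<le> n then x (Inl (k - 1)) * y (Inl 1) else 0)"
    by (subst sum_sum_delta) auto
  finally show ?thesis by simp
qed

text \<open>Here the bound is 2, since \<open>X 1\<close> already moves \<open>Y 1\<close>. The
  bounds on \<open>k\<close> say nothing about \<open>n\<close>, so \<open>1 \<le> n\<close> has to
  guarantee that \<open>X 1\<close> occurs in the sum.\<close>

lemma filiform_bracket_Inr:
  fixes x y :: "nat + nat \<Rightarrow> 'a::field"
  assumes "1 \<le> n"
  shows "filiform_bracket n m x y (Inr k) =
     (if 2 \<le> k \<and> k \<le> m then x (Inl 1) * y (Inr (k - 1)) - x (Inr (k - 1)) * y (Inl 1) else 0)"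
proof -
  let ?A = "\<lambda>i j. if i = 1 \<and> k = Suc j \<and> 2 \<le> k \<and> k \<le> m then x (Inl i) * y (Inr j) else 0"
  let ?B = "\<lambda>j i. if i = 1 \<and> k = Suc j \<and> 2 \<le> k \<and> k \<le> m then - x (Inr j) * y (Inl i) else 0"
  have "filiform_bracket n m x y (Inr k) =
      (\<Sum>i\<in>{1..n}. \<Sum>j\<in>{1..m}. ?A i j) + (\<Sum>j\<in>{1..m}. \<Sum>i\<in>{1..n}. ?B j i)"
  proof -
    have table:
      "fscale (x (Inl i) * y (Inr j)) (filiform_table n m (Inl i) (Inr j)) (Inr k) = ?A i j"
      "fscale (x (Inr j) * y (Inl i)) (filiform_table n m (Inr j) (Inl i)) (Inr k) = ?B j i"
      "fscale c (filiform_table n m (Inl i) (Inl j)) (Inr k) = 0"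
      "fscale c (filiform_table n m (Inr i) (Inr j)) (Inr k) = 0"
      for i j and c :: 'a
      by (auto simp: fscale_def basis_vec_def)
    show ?thesis
      unfolding filiform_bracket_def fun_sum_apply
      by (simp add: sum.Plus table sum.distrib del: filiform_table.simps)
  qed
  also have "(\<Sum>i\<in>{1..n}. \<Sum>j\<in>{1..m}. ?A i j) =
      (\<Sum>i\<in>{1..n}. \<Sum>j\<in>{1..m}. if i = 1 \<and> j = k - 1 then
        (if 2 \<le> k \<and> k \<le> m then x (Inl 1) * y (Inr (k - 1)) else 0) else 0)"
    by (intro sum.cong refl) auto
  also have "\<dots> = (if 2 \<le> k \<and> k \<le> m then x (Inl 1) * y (Inr (k - 1)) else 0)"
    using assms by (subst sum_sum_delta) auto
  also have "(\<Sum>j\<in>{1..m}. \<Sum>i\<in>{1..n}. ?B j i) =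
      (\<Sum>j\<in>{1..m}. \<Sum>i\<in>{1..n}. if j = k - 1 \<and> i = 1 then
        (if 2 \<le> k \<and> k \<le> m then - x (Inr (k - 1)) * y (Inl 1) else 0) else 0)"
    by (intro sum.cong refl) auto
  also have "\<dots> = (if 2 \<le> k \<and> k \<le> m then - x (Inr (k - 1)) * y (Inl 1) else 0)"
    using assms by (subst sum_sum_delta) auto
  finally show ?thesis by simp
qed

lemmas filiform_bracket_apply = filiform_bracket_Inl filiform_bracket_Inr

text \<open>Signs only matter for two odd arguments, and then all the brackets involved vanish.\<close>

lemma lie_superalgebra_filiform:
  assumes "1 \<le> n"
  shows "lie_superalgebra (fscale :: 'a::field \<Rightarrow> _) (filiform_part n m) (filiform_bracket n m)"
proof
  show "fvec.subspace (filiform_part n m i :: (nat + nat \<Rightarrow> 'a) set)" for i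
    by (rule subspace_filiform_part)
  show "filiform_part n m 0 \<inter> filiform_part n m 1 = {0 :: nat + nat \<Rightarrow> 'a}"
    by (auto simp: mem_filiform_part_0 mem_filiform_part_1 fun_eq_iff split_sum_all)
  show "bilinear_bracket_on (fscale :: 'a \<Rightarrow> _) (super_carrier (filiform_part n m))
      (filiform_bracket n m)"
    unfolding bilinear_bracket_on_def mem_super_carrier_filiform_part
    using assms
    by (auto simp: fun_eq_iff split_sum_all fscale_def filiform_bracket_apply algebra_simps)
next
  fix x y :: "nat + nat \<Rightarrow> 'a" and i j
  assume x: "x \<in> filiform_part n m i" and y: "y \<in> filiform_part n m j"
  show "filiform_bracket n m x y \<in> filiform_part n m (i + j)"
    using x y assms
    by (cases i; cases j)
       (auto simp: mem_filiform_part_0 mem_filiform_part_1 filiform_bracket_apply)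
  show "filiform_bracket n m x y = - fscale (super_sign i j) (filiform_bracket n m y x)"
    using x y assms
    by (cases i; cases j)
       (auto simp: mem_filiform_part_0 mem_filiform_part_1 fun_eq_iff split_sum_all fscale_def
          super_sign_def filiform_bracket_apply)
next
  fix x y z :: "nat + nat \<Rightarrow> 'a" and i j k
  assume "x \<in> filiform_part n m i" "y \<in> filiform_part n m j" "z \<in> filiform_part n m k"
  then show "filiform_bracket n m x (filiform_bracket n m y z) =
      filiform_bracket n m (filiform_bracket n m x y) z +
      fscale (super_sign i j) (filiform_bracket n m y (filiform_bracket n m x z))"
    \<comment> \<open>The sign depends on \<open>i\<close> and \<open>j\<close> only, so the parity
      of \<open>z\<close> needs no case split; what remains are polynomial identities in
      coordinates.\<close>
    using assms
    by (cases i; cases j)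
       (auto simp: mem_filiform_part_0 mem_filiform_part_1 fun_eq_iff split_sum_all fscale_def
          super_sign_def filiform_bracket_apply algebra_simps)
qed

section \<open>Nilpotency of ad x for even x\<close>

lemma filiform_bracket_zero_right: "filiform_bracket n m x 0 = 0"
  by (simp add: filiform_bracket_def fscale_def fun_eq_iff fun_sum_apply)

text \<open>The first bracket clears coordinates 1 and 2 at once. From then on the argument has no
  \<open>X 1\<close> component, so each further bracket is a pure shift and clears one more
  coordinate.\<close>

lemma filiform_bracket_pow_Inl:
  assumes "1 \<le> d" "k \<le> d + 1"
  shows "(filiform_bracket n m x ^^ d) y (Inl k) = 0"
  using assms
proof (induction d arbitrary: k)
  case (Suc d)
  then show ?case by (cases d) (auto simp: filiform_bracket_Inl)
qed simp

text \<open>An even \<open>x\<close> acts on odd coordinates as a multiple of the shift. As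
  \<open>y\<close> is arbitrary, \<open>1 \<le> k\<close> is what makes the case
  \<open>d = 0\<close> vacuous.\<close>

lemma filiform_bracket_pow_Inr:
  assumes "1 \<le> n" "\<And>j. x (Inr j) = 0" "1 \<le> k" "k \<le> d"
  shows "(filiform_bracket n m x ^^ d) y (Inr k) = 0"
  using assms(3,4)
proof (induction d arbitrary: k)
  case (Suc d)
  then show ?case by (auto simp: filiform_bracket_Inr[OF assms(1)] assms(2))
qed simp

lemma filiform_bracket_pow_eq_0:
  assumes "1 \<le> n" "1 \<le> d" "n \<le> d + 1" "m \<le> d" "x \<in> filiform_part n m 0"
  shows "(filiform_bracket n m x ^^ d) y = 0"
proof -
  \<comment> \<open>Exposes the outermost bracket: its coordinate formula disposes of the indices
    that the two preceding lemmas miss, whatever the support of \<open>y\<close>.\<close>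
  obtain e where d: "d = Suc e" using assms(2) by (cases d) auto
  have "(filiform_bracket n m x ^^ d) y (Inl k) = 0" for k
  proof (cases "k \<le> d + 1")
    case False
    then show ?thesis using assms by (simp add: d filiform_bracket_Inl)
  qed (use assms filiform_bracket_pow_Inl in blast)
  moreover have "(filiform_bracket n m x ^^ d) y (Inr k) = 0" for k
  proof (cases "1 \<le> k \<and> k \<le> d")
    case False
    then show ?thesis using assms by (auto simp: d filiform_bracket_Inr)
  qed (use assms filiform_bracket_pow_Inr mem_filiform_part_0 in blast)
  ultimately show ?thesis by (simp add: fun_eq_iff split_sum_all)
qed

section \<open>Vanishing of Jacobson's elements\<close>

lemma coeff_ad_poly_filiform:
  "coeff (ad_poly (filiform_bracket n m) x y q) i =
     (case i of 0 \<Rightarrow> 0 | Suc l \<Rightarrow> filiform_bracket n m x (coeff q l)) +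
     filiform_bracket n m y (coeff q i)"
  by (simp add: ad_poly_def coeff_map_poly filiform_bracket_zero_right coeff_pCons split: nat.split)

text \<open>The induction of \<open>filiform_bracket_pow_Inl\<close> does not care which element
  brackets at each stage, so it survives mixing \<open>x\<close> and \<open>y\<close>. It runs over
  all \<open>i\<close> at once because a coefficient draws on its predecessor.\<close>

lemma coeff_ad_poly_pow_Inl:
  assumes "1 \<le> d" "k \<le> d + 1"
  shows "coeff ((ad_poly (filiform_bracket n m) x y ^^ d) q) i (Inl k) = 0"
  using assms
proof (induction d arbitrary: k i)
  case (Suc d)
  then show ?case
    by (cases d) (auto simp: coeff_ad_poly_filiform filiform_bracket_Inl split: nat.split)
qed simp

lemma coeff_ad_poly_pow_mem:
  assumes "1 \<le> n" "x \<in> filiform_part n m 0" "y \<in> filiform_part n m 0" "z \<in> filiform_part n m 0"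
  shows "coeff ((ad_poly (filiform_bracket n m) x y ^^ d) [:z:]) i \<in> filiform_part n m 0"
proof (induction d arbitrary: i)
  case 0
  then show ?case
    using assms(4) by (cases i) (auto simp: coeff_pCons mem_filiform_part_0)
next
  case (Suc d)
  then show ?case
    using assms(1-3)
    by (auto simp: coeff_ad_poly_filiform mem_filiform_part_0 filiform_bracket_apply
        split: nat.split)
qed

lemma jacobson_s_filiform_eq_0:
  assumes "2 \<le> p" "1 \<le> n" "n \<le> p" "x \<in> filiform_part n m 0" "y \<in> filiform_part n m 0"
  shows "jacobson_s fscale (filiform_bracket n m) p i x y = 0"
proof -
  let ?c = "coeff ((ad_poly (filiform_bracket n m) x y ^^ (p - 1)) [:x:]) (i - 1)"
  have mem: "?c \<in> filiform_part n m 0"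
    using coeff_ad_poly_pow_mem assms by blast
  have "?c (Inl k) = 0" for k
  proof (cases "k \<le> n")
    case True
    \<comment> \<open>Borderline case: \<open>p - 1\<close> brackets clear the coordinates up to
      \<open>p\<close>, just enough for \<open>n \<le> p\<close>.\<close>
    then show ?thesis using assms by (intro coeff_ad_poly_pow_Inl) auto
  qed (use mem in \<open>simp add: mem_filiform_part_0\<close>)
  with mem have "?c = 0"
    by (simp add: mem_filiform_part_0 fun_eq_iff split_sum_all)
  then show ?thesis by (simp add: jacobson_s_def fscale_def fun_eq_iff)
qed

section \<open>Properties of the p-map\<close>

lemma filiform_pmap_mem:
  assumes "1 \<le> p"
  shows "filiform_pmap p lam x \<in> filiform_part p m 0"
  using assms by (auto simp: filiform_pmap_def mem_filiform_part_0 fscale_def basis_vec_def)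

text \<open>Values of the p-map are multiples of \<open>X p\<close>. This differs from
  \<open>X 1\<close> because \<open>1 < p\<close>, and \<open>X 1\<close> would shift it past the
  last index.\<close>

lemma filiform_bracket_pmap:
  assumes "1 < p" "y \<in> filiform_part p m 0 \<or> y \<in> filiform_part p m 1"
  shows "filiform_bracket p m (filiform_pmap p lam x) y = 0"
  using assms
  by (auto simp: fun_eq_iff split_sum_all filiform_bracket_apply filiform_pmap_def fscale_def
      basis_vec_def)

lemma filiform_pmap_scale:
  "filiform_pmap p lam (fscale c x) = fscale (c ^ p) (filiform_pmap p lam x)"
  by (simp add: filiform_pmap_def fscale_def fun_eq_iff power_mult_distrib sum_distrib_left
      sum_distrib_right mult.assoc)

lemma filiform_pmap_add:
  fixes lam :: "nat \<Rightarrow> 'a::field"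
  assumes "CHAR('a) = p" "prime p"
  shows "filiform_pmap p lam (x + y) = filiform_pmap p lam x + filiform_pmap p lam y"
proof -
  have "(a + b) ^ p = a ^ p + b ^ p" for a b :: 'a
    using assms by (intro freshmans_dream) auto
  then show ?thesis
    by (simp add: filiform_pmap_def fscale_def fun_eq_iff algebra_simps sum.distrib)
qed

theorem mainTheorem4:
  fixes p :: nat and lam :: "nat \<Rightarrow> 'a::alg_closed_field"
  assumes "CHAR('a) = p" and "p > 2"
  shows "restricted_lie_superalgebra fscale (filiform_part p p) (filiform_bracket p p) p
           (filiform_pmap p lam)"
proof -
  have p: "1 \<le> p" "1 < p" using assms(2) by auto
  \<comment> \<open>A nonzero characteristic of a domain is prime.\<close>
  have prime: "prime p"
    using assms prime_CHAR_semidom[where 'a = 'a] by auto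
  interpret L: lie_superalgebra "fscale :: 'a \<Rightarrow> _" "filiform_part p p" "filiform_bracket p p"
    using p(1) by (rule lie_superalgebra_filiform)
  have pow: "(filiform_bracket p p x ^^ p) y = 0"
    if "x \<in> filiform_part p p 0" for x y :: "nat + nat \<Rightarrow> 'a"
    using that p by (intro filiform_bracket_pow_eq_0) auto
  have sub: "filiform_part p p 0 \<subseteq> super_carrier (filiform_part p p :: bit \<Rightarrow> (nat + nat \<Rightarrow> 'a) set)"
    by (auto simp: mem_filiform_part_0 mem_super_carrier_filiform_part)
  show ?thesis
  proof
    show "bilinear_bracket_on (fscale :: 'a \<Rightarrow> _) (filiform_part p p 0) (filiform_bracket p p)"
      using L.bilinear_super L.bracket_even[of _ 0 _ 0] sub
      unfolding bilinear_bracket_on_def by (auto simp: subset_iff)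
  next
    fix x :: "nat + nat \<Rightarrow> 'a" assume x: "x \<in> filiform_part p p 0"
    \<comment> \<open>Read off from coordinates; super-skew-symmetry would only give that twice the
      bracket is zero.\<close>
    show "filiform_bracket p p x x = 0"
      using p by (simp add: fun_eq_iff split_sum_all filiform_bracket_apply)
    fix y z :: "nat + nat \<Rightarrow> 'a" assume y: "y \<in> filiform_part p p 0"
    show "filiform_pmap p lam (x + y) = filiform_pmap p lam x + filiform_pmap p lam y +
        (\<Sum>i=1..p-1. jacobson_s fscale (filiform_bracket p p) p i x y)"
      using x y p assms(1) prime
      by (simp add: jacobson_s_filiform_eq_0 filiform_pmap_add)
    assume "z \<in> filiform_part p p 0"
    with x y show "filiform_bracket p p x (filiform_bracket p p y z) =
        filiform_bracket p p (filiform_bracket p p x y) z +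
        filiform_bracket p p y (filiform_bracket p p x z)"
      using L.super_jacobi[of x 0 y 0 z 0] by (simp add: super_sign_def)
  qed (use p prime assms(1) in \<open>auto simp: pow subspace_filiform_part filiform_pmap_mem
         filiform_pmap_scale filiform_bracket_pmap\<close>)
qed

end
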